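(* For all positive integers $k, d$ and every real $\epsilon > 0$, there exists an acyclic bipartite digraph $D$ such that $\gamma(D) < k + \frac{d-k}{d+1} + \epsilon$ and $\Delta^{-}(D) \leq k+1$, but $D$ cannot be decomposed into $k+1$ branchings $B_{1}, \ldots, B_{k}, B_{k+1}$ with $\Delta^{+}(B_{k+1}) \leq d$.
   Context: Digraphs are finite, may have multiple arcs, and have no loops. For a digraph $D$, $V(D)$ is its vertex set and $A(D)$ its arc set. $D$ is acyclic if it contains no directed cycle, and bipartite if its underlying (undirected multi)graph is bipartite. For $v \in V(D)$, $d_D^-(v)$ is the number of arcs of $D$ with head $v$ and $d_D^+(v)$ is the number of arcs of $D$ with tail $v$; $\Delta^-(D) = \max_{v \in V(D)} d_D^-(v)$ and $\Delta^+(D) = \max_{v \in V(D)} d_D^+(v)$. The fractional arboricity of $D$ is $\gamma(D) = \max_{H \subseteq D, |V(H)|>1} \frac{|A(H)|}{|V(H)|-1}$, the maximum being over subdigraphs $H$ of $D$ with more than one vertex (arcs counted with multiplicity). A subdigraph of $D$ is spanning if its vertex set is $V(D)$. A subdigraph $F$ of $D$ is an arborescence with root $r \in V(F)$ if its underlying graph is a tree and for every $u \in V(F)$ there is exactly one directed path in $F$ from $r$ to $u$ (a single vertex is an arborescence). A branching in $D$ is a spanning subdigraph each (weakly connected) component of which is an arborescence; it may have no arcs. A decomposition of $D$ into subdigraphs is a family of pairwise arc-disjoint subdigraphs whose union is $D$. *)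

theory Defs
  imports Complex_Main "HOL-Library.Disjoint_Sets" "Graph_Theory.Digraph_Component"
begin

text \<open>
  The locale \<open>digraph\<close> of the Graph Theory library forbids parallel arcs, so it is not
  used here. A vertex is required so that maximum degrees are maxima of nonempty sets.
\<close>

locale multi_digraph = fin_digraph + loopfree_digraph +
  assumes verts_nonempty: "verts G \<noteq> {}"

definition acyclic_digraph :: "('a, 'b) pre_digraph \<Rightarrow> bool" where
  "acyclic_digraph D \<longleftrightarrow> \<not> (\<exists>p. pre_digraph.cycle D p)"

definition bipartite_digraph :: "('a, 'b) pre_digraph \<Rightarrow> bool" where
  "bipartite_digraph D \<longleftrightarrow>
    (\<exists>X Y. X \<union> Y = verts D \<and> X \<inter> Y = {} \<and>
      (\<forall>e \<in> arcs D. tail D e \<in> X \<and> head D e \<in> Y \<or> tail D e \<in> Y \<and> head D e \<in> X))"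

definition max_in_degree :: "('a, 'b) pre_digraph \<Rightarrow> nat" where
  "max_in_degree D = Max (in_degree D ` verts D)"

definition max_out_degree :: "('a, 'b) pre_digraph \<Rightarrow> nat" where
  "max_out_degree D = Max (out_degree D ` verts D)"

text \<open>
  A subgraph in the library's sense carries the tail and head functions of \<open>D\<close>, so a finite
  \<open>D\<close> has finitely many subgraphs. The set below is empty only if \<open>D\<close> has at most one vertex.
\<close>

definition fractional_arboricity :: "('a, 'b) pre_digraph \<Rightarrow> real" where
  "fractional_arboricity D =
    Max {real (card (arcs H)) / (real (card (verts H)) - 1) | H.
          subgraph H D \<and> card (verts H) > 1}"

text \<open>
  The underlying undirected multigraph: every arc \<open>e\<close> becomes an edge that can be traversed
  in both directions, as \<open>(e, True)\<close> from tail to head and as \<open>(e, False)\<close> from head to tail.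
\<close>

definition underlying_multigraph :: "('a, 'b) pre_digraph \<Rightarrow> ('a, 'b \<times> bool) pre_digraph" where
  "underlying_multigraph D =
    \<lparr> verts = verts D, arcs = arcs D \<times> UNIV,
      tail = (\<lambda>(e, forward). if forward then tail D e else head D e),
      head = (\<lambda>(e, forward). if forward then head D e else tail D e) \<rparr>"

text \<open>
  A cycle of the underlying multigraph may not use the same edge in both directions; two
  parallel or antiparallel arcs do form a cycle. The library's \<open>tree\<close> only excludes
  directed cycles and hence does not express that the underlying graph is a tree.
\<close>

definition underlying_tree :: "('a, 'b) pre_digraph \<Rightarrow> bool" where
  "underlying_tree F \<longleftrightarrow> Digraph_Component.connected F \<and>
    \<not> (\<exists>p. pre_digraph.cycle (underlying_multigraph F) p \<and> distinct (map fst p))"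

definition arborescence :: "('a, 'b) pre_digraph \<Rightarrow> 'a \<Rightarrow> bool" where
  "arborescence F r \<longleftrightarrow> wf_digraph F \<and> r \<in> verts F \<and> underlying_tree F \<and>
    (\<forall>u \<in> verts F. \<exists>!p. pre_digraph.apath F r p u)"

text \<open>Weakly connected components: \<open>connected\<close> in the library ignores orientations.\<close>

definition weak_component :: "('a, 'b) pre_digraph \<Rightarrow> ('a, 'b) pre_digraph \<Rightarrow> bool" where
  "weak_component C D \<longleftrightarrow> pre_digraph.max_subgraph D Digraph_Component.connected C"

definition branching :: "('a, 'b) pre_digraph \<Rightarrow> ('a, 'b) pre_digraph \<Rightarrow> bool" where
  "branching B D \<longleftrightarrow> spanning B D \<and> (\<forall>C. weak_component C B \<longrightarrow> (\<exists>r. arborescence C r))"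

definition decomposition ::
    "('a, 'b) pre_digraph \<Rightarrow> 'i set \<Rightarrow> ('i \<Rightarrow> ('a, 'b) pre_digraph) \<Rightarrow> bool" where
  "decomposition D I B \<longleftrightarrow>
    (\<forall>i \<in> I. subgraph (B i) D) \<and>
    disjoint_family_on (\<lambda>i. arcs (B i)) I \<and>
    pre_digraph.Union D (B ` I) = D"

end

theory Submission
  imports Defs
begin

text \<open>
  The digraph has \<open>n\<close> sources, and all arcs go from a source to one of \<open>d n + 1\<close> sinks of
  in-degree \<open>k + 1\<close>. A branching contains at most one arc into each sink, so in a decomposition
  into \<open>k + 1\<close> branchings each of them contains exactly one, which is impossible for the last one
  because its \<open>n\<close> sources have out-degree at most \<open>d\<close>.

  It remains to choose the arcs so that every subdigraph is sparse. All but \<open>k d + 1\<close> of the sinks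
  form a strip: \<open>d\<close> sinks for each position \<open>j\<close>, with arcs from the sources \<open>j, \<dots>, j + k\<close>. In a strip
  every subdigraph with \<open>v\<close> vertices has at most \<open>c (v - 1)\<close> arcs, where
  \<open>c = (k + 1) d / (d + 1) = k + (d - k) / (d + 1)\<close>. The remaining sinks take their arcs from pairwise
  different sources, the hubs, with large gaps between them. In a subdigraph that is large compared
  to the number of these additional arcs, they cost at most \<open>\<epsilon> (v - 1)\<close>. A small subdigraph can be
  cut between any two of its hubs; each piece of the strip saves \<open>c \<ge> 1\<close>, which pays for the
  additional arc at its hub.
\<close>

section \<open>Arc counts in the strip and at the hubs\<close>

text \<open>Used for the sinks of one residue class modulo \<open>d\<close>, with \<open>T\<close>
  the set of their positions. A shift \<open>i\<close> accounts for at most min(|T|, |S|) arcs. If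
  the cardinalities differ, each shift gains at least 1 against the bound. If they agree, a shift
  can only be full when \<open>S\<close> is the translate of \<open>T\<close> by \<open>i\<close>,
  so all shifts but one lose an arc.\<close>

lemma level_bound:
  fixes S T :: "nat set"
  assumes fin: "finite S" "finite T" and ne: "S \<noteq> {}" and k: "k > 0" and d: "d > 0"
  shows "(d + 1) * (\<Sum>j\<in>T. card {i \<in> {..k}. j + i \<in> S}) + (k + 1)
    \<le> (k + 1) * (d * card T + card S)"
proof -
  define a where "a i = card {j \<in> T. j + i \<in> S}" for i
  have swap: "(\<Sum>j\<in>T. card {i \<in> {..k}. j + i \<in> S}) = (\<Sum>i\<le>k. a i)"
    using fin by (intro sum_multicount_gen) (auto simp: a_def)
  have a_T: "a i \<le> card T" for i
    unfolding a_def using fin by (intro card_mono) auto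
  have a_S: "a i \<le> card S" for i
    unfolding a_def using fin by (intro card_inj_on_le[where f = "\<lambda>j. j + i"]) auto
  show ?thesis
  proof (cases "card T = card S")
    case False
    have "(d + 1) * a i + 1 \<le> d * card T + card S" for i
    proof (cases "card T < card S")
      case True
      then show ?thesis using mult_le_mono2[OF a_T, of "d + 1" i] by simp
    next
      case F: False
      with False have "card S + 1 \<le> card T" by simp
      then have "d * (card S + 1) \<le> d * card T" by (rule mult_le_mono2)
      then show ?thesis using mult_le_mono2[OF a_S, of "d + 1" i] d by simp
    qed
    then have "(\<Sum>i\<le>k. (d + 1) * a i + 1) \<le> (\<Sum>i\<le>k. d * card T + card S)"
      by (intro sum_mono)
    then have "(d + 1) * (\<Sum>i\<le>k. a i) + (k + 1) \<le> (\<Sum>i\<le>k. d * card T + card S)"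
      by (simp only: sum.distrib sum_constant card_atMost flip: sum_distrib_left) simp
    then show ?thesis unfolding swap by simp
  next
    case eq: True
    define s where "s = card S"
    have s: "s > 0" using fin ne by (auto simp: s_def card_gt_0_iff)
    \<comment> \<open>Comparing element sums recovers the shift from \<open>S\<close> and
      \<open>T\<close>, since \<open>s > 0\<close>.\<close>
    have shift: "\<Sum>S = \<Sum>T + i * s" if "a i = s" for i
    proof -
      have "{j \<in> T. j + i \<in> S} = T"
        using that fin eq unfolding a_def s_def by (intro card_subset_eq) auto
      then have "(\<lambda>j. j + i) ` T \<subseteq> S" by auto
      moreover have "card ((\<lambda>j. j + i) ` T) = card S" using eq by (subst card_image) auto
      ultimately have "S = (\<lambda>j. j + i) ` T" using fin by (metis card_subset_eq)
      then have "\<Sum>S = (\<Sum>j\<in>T. j + i)" by (simp add: sum.reindex)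
      then show ?thesis using eq by (simp add: sum.distrib s_def)
    qed
    define G where "G = {i \<in> {..k}. a i = s}"
    \<comment> \<open>By \<open>shift\<close>, at most one translate of \<open>T\<close> equals \<open>S\<close>.\<close>
    have "card G \<le> 1"
    proof (rule ccontr)
      assume "\<not> card G \<le> 1"
      then obtain i i' where "i \<in> G" "i' \<in> G" "i \<noteq> i'"
        using card_le_Suc0_iff_eq[of G] by (auto simp: G_def)
      with shift[of i] shift[of i'] s show False by (auto simp: G_def)
    qed
    have "(\<Sum>i\<le>k. a i) + (k + 1) = (\<Sum>i\<le>k. a i + 1)" by (simp only: sum.distrib) simp
    also have "\<dots> \<le> (\<Sum>i\<le>k. s + (if i \<in> G then 1 else 0))"
    proof (rule sum_mono)
      fix i assume "i \<in> {..k}"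
      with a_S[of i] show "a i + 1 \<le> s + (if i \<in> G then 1 else 0)" by (auto simp: G_def s_def)
    qed
    also have "\<dots> = (k + 1) * s + card G"
      by (simp add: sum.distrib sum.If_cases G_def Int_def)
    finally have "(\<Sum>i\<le>k. a i) + k \<le> (k + 1) * s" using \<open>card G \<le> 1\<close> by linarith
    from mult_le_mono2[OF this, of "d + 1"]
    have "(d + 1) * (\<Sum>i\<le>k. a i) + (d + 1) * k \<le> (d + 1) * ((k + 1) * s)"
      by (simp only: distrib_left)
    \<comment> \<open>The loss of at least \<open>k\<close> arcs is weighted by
      \<open>d + 1\<close>, which covers the required slack \<open>k + 1\<close>.\<close>
    moreover have "k + 1 \<le> (d + 1) * k" using k d by (cases d) auto
    moreover have "(d + 1) * ((k + 1) * s) = (k + 1) * (d * card T + card S)"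
      using eq by (simp add: s_def algebra_simps)
    ultimately show ?thesis unfolding swap by linarith
  qed
qed

text \<open>Sinks with the same residue modulo \<open>d\<close> have different positions, so
  \<open>level_bound\<close> applies to each of the \<open>d\<close> classes. Summing counts
  \<open>S\<close> once per class and accumulates the slack \<open>(k + 1) * d\<close>, which is
  \<open>c\<close> after division by \<open>d + 1\<close>.\<close>

lemma strip_bound:
  fixes S W :: "nat set"
  assumes fin: "finite S" "finite W" and ne: "S \<noteq> {} \<or> W \<noteq> {}" and k: "k > 0" and d: "d > 0"
  shows "(d + 1) * (\<Sum>y\<in>W. card {i \<in> {..k}. y div d + i \<in> S}) + (k + 1) * d
    \<le> (k + 1) * d * (card S + card W)"
proof (cases "S = {}")
  case True
  then have "card W \<ge> 1" using ne fin by (simp add: Suc_leI card_gt_0_iff)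
  from mult_le_mono2[OF this, of "(k + 1) * d"] True show ?thesis by simp
next
  case False
  define F where "F y = card {i \<in> {..k}. y div d + i \<in> S}" for y
  define W' where "W' r = {y \<in> W. y mod d = r}" for r
  have level: "(d + 1) * sum F (W' r) + (k + 1) \<le> (k + 1) * (d * card (W' r) + card S)" for r
  proof -
    have inj: "inj_on (\<lambda>y. y div d) (W' r)"
      by (rule inj_onI) (metis (mono_tags, lifting) W'_def div_mult_mod_eq mem_Collect_eq)
    have "finite ((\<lambda>y. y div d) ` W' r)" using fin by (simp add: W'_def)
    from level_bound[OF fin(1) this False k d] show ?thesis
      by (simp add: sum.reindex[OF inj] card_image[OF inj] F_def)
  qed
  have part: "(\<Sum>r<d. sum g (W' r)) = sum g W" for g :: "nat \<Rightarrow> nat"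
    unfolding W'_def using fin d by (intro sum.group) auto
  have "(\<Sum>r<d. (d + 1) * sum F (W' r) + (k + 1)) \<le> (\<Sum>r<d. (k + 1) * (d * card (W' r) + card S))"
    by (intro sum_mono level)
  moreover have "(\<Sum>r<d. (d + 1) * sum F (W' r) + (k + 1)) = (d + 1) * sum F W + (k + 1) * d"
    by (simp only: sum.distrib sum_constant part card_lessThan flip: sum_distrib_left) simp
  moreover have "(\<Sum>r<d. (k + 1) * (d * card (W' r) + card S)) = (k + 1) * d * (card S + card W)"
    using part[of "\<lambda>_. 1"]
    by (simp add: sum.distrib algebra_simps flip: sum_distrib_left)
  ultimately show ?thesis unfolding F_def by simp
qed

text \<open>Hubs are the multiples of \<open>L\<close>, and each hub in \<open>S\<close> is charged
  one additional arc. Induction on the number of hubs: a single one is paid for by the slack of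
  \<open>strip_bound\<close>; between two of them, at most \<open>M\<close> sinks cannot bridge the
  gap, so the strip is cut there without losing an arc.\<close>

lemma hub_bound:
  fixes S W :: "nat set"
  assumes "finite S" "finite W" and k: "k > 0" and d: "d > 0"
    and "card W \<le> M" and L: "L = (k + 1) * (M + 1)"
  shows "(d + 1) * ((\<Sum>y\<in>W. card {i \<in> {..k}. y div d + i \<in> S}) + card {q \<in> S. L dvd q})
    \<le> (k + 1) * d * (card S + card W)"
  using assms(1,2,5)
proof (induction "card {q \<in> S. L dvd q}" arbitrary: S W rule: less_induct)
  case less
  let ?F = "\<lambda>S y. card {i \<in> {..k}. y div d + i \<in> S}"
  let ?Q = "\<lambda>S. {q \<in> S. L dvd q}"
  note fin = \<open>finite S\<close> \<open>finite W\<close>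
  show ?case
  proof (cases "card (?Q S) \<le> 1")
    case True
    show ?thesis
    proof (cases "S = {} \<and> W = {}")
      case False
      have "(d + 1) * card (?Q S) \<le> d + 1" using True by (cases "card (?Q S)") auto
      \<comment> \<open>This is \<open>c \<ge> 1\<close>: the slack of one piece pays for one
        arc.\<close>
      also have "d + 1 \<le> (k + 1) * d" using k d by (cases k) auto
      finally have "(d + 1) * card (?Q S) \<le> (k + 1) * d" .
      moreover have "S \<noteq> {} \<or> W \<noteq> {}" using False by simp
      ultimately show ?thesis
        using strip_bound[OF fin _ k d] unfolding distrib_left[of "d + 1"] by fastforce
    qed simp
  next
    case False
    then obtain q q' where "q \<in> ?Q S" "q' \<in> ?Q S" "q \<noteq> q'"
      using card_le_Suc0_iff_eq[of "?Q S"] fin by auto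
    then obtain q1 q2 where q: "q1 \<in> ?Q S" "q2 \<in> ?Q S" "q1 < q2"
      using nat_neq_iff by blast
    then have "L dvd q2 - q1" by (intro dvd_diff_nat) auto
    with q have "L \<le> q2 - q1" by (intro dvd_imp_le) auto
    with q have gap: "q1 + L \<le> q2" by simp
    \<comment> \<open>Of the \<open>M + 1\<close> windows of length \<open>k + 1\<close> after \<open>q1\<close>, one contains no position of \<open>W\<close>.\<close>
    let ?blk = "\<lambda>y. (y div d - q1) div (k + 1)"
    have "card (?blk ` W) < card {..M}"
      using card_image_le[OF fin(2), of ?blk] less.prems by simp
    then have "\<not> {..M} \<subseteq> ?blk ` W" using fin card_mono[of "?blk ` W" "{..M}"] by auto
    then obtain m where m: "m \<le> M" "m \<notin> ?blk ` W" by auto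
    define z where "z = q1 + (m + 1) * (k + 1)"
    have "(m + 1) * (k + 1) \<le> L" unfolding L by (subst mult.commute, rule mult_le_mono2) (use m in simp)
    then have z: "q1 < z" "z \<le> q2" using gap by (auto simp: z_def)
    \<comment> \<open>Otherwise the position would be among the last \<open>k\<close> before
      \<open>z\<close>, hence in the empty window, which ends at \<open>z\<close>. So sinks left of
      the cut have all their tails left of it.\<close>
    have clear: "y div d + k < z" if "y \<in> W" "y div d < z" for y
    proof (rule ccontr)
      assume "\<not> y div d + k < z"
      then have "(y div d - q1) div (k + 1) = m"
        using that(2) by (intro div_nat_eqI) (auto simp: z_def algebra_simps)
      with m that show False by auto
    qed
    define S1 S2 where "S1 = {x \<in> S. x < z}" and "S2 = {x \<in> S. z \<le> x}"
    define W1 W2 where "W1 = {y \<in> W. y div d < z}" and "W2 = {y \<in> W. z \<le> y div d}"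
    have S: "S = S1 \<union> S2" "S1 \<inter> S2 = {}" and W: "W = W1 \<union> W2" "W1 \<inter> W2 = {}"
      by (auto simp: S1_def S2_def W1_def W2_def)
    have fin': "finite S1" "finite S2" "finite W1" "finite W2" using fin S W by auto
    have cS: "card S = card S1 + card S2" and cW: "card W = card W1 + card W2"
      using S W fin' by (simp_all add: card_Un_disjoint)
    have "?Q S = ?Q S1 \<union> ?Q S2" using S by auto
    moreover have "?Q S1 \<inter> ?Q S2 = {}" using S by auto
    ultimately have cQ: "card (?Q S) = card (?Q S1) + card (?Q S2)"
      using fin' by (simp add: card_Un_disjoint)
    \<comment> \<open>Each piece keeps a hub, so each has fewer hubs than \<open>S\<close> and the
      induction hypothesis applies to both.\<close>
    have "q1 \<in> ?Q S1" "q2 \<in> ?Q S2" using q z by (auto simp: S1_def S2_def)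
    then have pos: "card (?Q S1) > 0" "card (?Q S2) > 0"
      using fin' by (auto simp: card_gt_0_iff)
    have 1: "?F S y = ?F S1 y" if "y \<in> W1" for y
      using clear[of y] that by (intro arg_cong[where f = card]) (auto simp: S1_def W1_def)
    have 2: "?F S y = ?F S2 y" if "y \<in> W2" for y
      using that by (intro arg_cong[where f = card]) (auto simp: S2_def W2_def)
    have "sum (?F S) W = sum (?F S) W1 + sum (?F S) W2"
      using W fin' by (simp add: sum.union_disjoint)
    also have "\<dots> = sum (?F S1) W1 + sum (?F S2) W2"
      using 1 2 by (intro arg_cong2[where f = "(+)"] sum.cong) auto
    finally have F: "sum (?F S) W = sum (?F S1) W1 + sum (?F S2) W2" .
    have "(d + 1) * (sum (?F S1) W1 + card (?Q S1)) \<le> (k + 1) * d * (card S1 + card W1)"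
      using pos cQ cW fin' less.prems by (intro less.hyps) auto
    moreover have "(d + 1) * (sum (?F S2) W2 + card (?Q S2)) \<le> (k + 1) * d * (card S2 + card W2)"
      using pos cQ cW fin' less.prems by (intro less.hyps) auto
    ultimately show ?thesis unfolding F cQ cS cW by (simp add: algebra_simps)
  qed
qed

section \<open>The placement of the arcs and its density\<close>

text \<open>The tail of the \<open>i\<close>-th arc into sink \<open>y\<close>. Sinks below
  \<open>b\<close> form the strip; for the others, \<open>(y - b) * (k + 1) + i\<close> numbers the
  hubs in base \<open>k + 1\<close>, so that no hub is used twice.\<close>

definition spread :: "nat \<Rightarrow> nat \<Rightarrow> nat \<Rightarrow> nat \<Rightarrow> nat \<Rightarrow> nat \<Rightarrow> nat" where
  "spread k d L b y i = (if y < b then y div d + i else ((y - b) * (k + 1) + i) * L)"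

text \<open>Three cases, with \<open>W\<close> the strip sinks and \<open>E\<close> the additional
  ones. If \<open>E\<close> is empty, \<open>strip_bound\<close> suffices. If \<open>W\<close> has
  at most \<open>M\<close> elements, \<open>hub_bound\<close> pays for the arcs into
  \<open>E\<close>. If \<open>W\<close> is larger, the bounded number of arcs into \<open>E\<close>
  is absorbed by \<open>\<epsilon>\<close>.\<close>

lemma spread_bound:
  fixes S Z :: "nat set" and \<epsilon> :: real and M :: nat
  assumes fin: "finite S" and k: "k > 0" and d: "d > 0" and \<epsilon>: "\<epsilon> > 0"
    and Z: "Z \<subseteq> {..<b + k * d + 1}" and card: "card S + card Z > 1"
    and M: "real ((k * d + 1) * (k + 1)) \<le> \<epsilon> * M" and L: "L = (k + 1) * (M + 1)"
  shows "(\<Sum>y\<in>Z. card {i \<in> {..k}. spread k d L b y i \<in> S})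
    < (real k + (real d - real k) / (real d + 1) + \<epsilon>) * (real (card S + card Z) - 1)"
proof -
  let ?F = "\<lambda>y. card {i \<in> {..k}. spread k d L b y i \<in> S}"
  let ?Q = "{q \<in> S. L dvd q}"
  define W E where "W = {y \<in> Z. y < b}" and "E = {y \<in> Z. b \<le> y}"
  have finZ: "finite Z" using Z finite_subset by blast
  have WE: "Z = W \<union> E" "W \<inter> E = {}" "finite W" "finite E"
    using finZ by (auto simp: W_def E_def)
  have cZ: "card Z = card W + card E" using WE by (simp add: card_Un_disjoint)
  have sumZ: "sum ?F Z = sum ?F W + sum ?F E" using WE by (simp add: sum.union_disjoint)
  have sumW: "sum ?F W = (\<Sum>y\<in>W. card {i \<in> {..k}. y div d + i \<in> S})"
    by (intro sum.cong) (auto simp: W_def spread_def)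
  have "E \<subseteq> {b..<b + (k * d + 1)}" using Z by (auto simp: E_def)
  then have "card E \<le> k * d + 1" using card_mono[of "{b..<b + (k * d + 1)}" E] by simp
  moreover have "sum ?F E \<le> (\<Sum>y\<in>E. k + 1)"
  proof (rule sum_mono)
    fix y show "?F y \<le> k + 1"
      using card_mono[of "{..k}" "{i \<in> {..k}. spread k d L b y i \<in> S}"] by auto
  qed
  moreover have "(\<Sum>y\<in>E. k + 1) = card E * (k + 1)" by simp
  ultimately have E_const: "sum ?F E \<le> (k * d + 1) * (k + 1)"
    using mult_le_mono1[of "card E" "k * d + 1" "k + 1"] by linarith
  \<comment> \<open>Different arcs into \<open>E\<close> have different hubs as tails; quotient and
    remainder modulo \<open>k + 1\<close> recover the arc from its hub.\<close>
  have E_hub: "sum ?F E \<le> card ?Q"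
  proof -
    let ?P = "SIGMA y:E. {i \<in> {..k}. spread k d L b y i \<in> S}"
    have inj: "inj_on (\<lambda>(y, i). spread k d L b y i) ?P"
    proof (rule inj_onI, clarify)
      fix y i y' i'
      assume *: "y \<in> E" "y' \<in> E" "i \<le> k" "i' \<le> k" "spread k d L b y i = spread k d L b y' i'"
      moreover have "spread k d L b y i = ((y - b) * (k + 1) + i) * L" if "y \<in> E" for y i
        using that by (simp add: spread_def E_def)
      ultimately have "((y - b) * (k + 1) + i) * L = ((y' - b) * (k + 1) + i') * L" by metis
      moreover have "L \<noteq> 0" unfolding L by simp
      ultimately have eq: "(y - b) * (k + 1) + i = (y' - b) * (k + 1) + i'"
        by (metis mult_right_cancel)
      from arg_cong[OF eq, of "\<lambda>u. u mod (k + 1)"] * have "i = i'"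
        by (simp del: mult_Suc_right add_Suc_right)
      moreover from arg_cong[OF eq, of "\<lambda>u. u div (k + 1)"] * have "y - b = y' - b"
        by (simp del: mult_Suc_right add_Suc_right)
      ultimately show "y = y' \<and> i = i'"
        using * by (metis (mono_tags, lifting) E_def eq_diff_iff mem_Collect_eq)
    qed
    have "sum ?F E = card ?P" using WE by simp
    also have "\<dots> \<le> card ?Q"
      using inj by (rule card_inj_on_le) (auto simp: E_def spread_def fin)
    finally show ?thesis .
  qed
  define N where "N = card S + card Z - 1"
  have N: "N > 0" "real (card S + card Z) - 1 = real N" using card by (auto simp: N_def)
  have c: "real k + (real d - real k) / (real d + 1) = real ((k + 1) * d) / real (d + 1)"
    by (simp add: field_simps)
  \<comment> \<open>In the cases without many strip sinks the bound holds with \<open>c\<close>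
    alone; \<open>\<epsilon>\<close> only makes it strict.\<close>
  have small: ?thesis if "(d + 1) * sum ?F Z \<le> (k + 1) * d * N"
  proof -
    have "real (d + 1) * real (sum ?F Z) \<le> real ((k + 1) * d) * real N"
      using that by (simp only: flip: of_nat_mult)
    then have "real (sum ?F Z) \<le> real ((k + 1) * d) / real (d + 1) * real N"
      by (simp add: pos_le_divide_eq mult.commute)
    also have "\<dots> < (real ((k + 1) * d) / real (d + 1) + \<epsilon>) * real N"
      using N \<epsilon> by (simp add: distrib_right)
    finally show ?thesis unfolding c N(2) .
  qed
  show ?thesis
  proof (cases "E = {}")
    case True
    have "S \<noteq> {} \<or> W \<noteq> {}" using card True WE by auto
    from strip_bound[OF fin \<open>finite W\<close> this k d]
    have "(d + 1) * sum ?F W + (k + 1) * d \<le> (k + 1) * d * (card S + card W)"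
      unfolding sumW .
    moreover have "(k + 1) * d * N = (k + 1) * d * (card S + card W) - (k + 1) * d"
      using True by (simp only: N_def cZ diff_mult_distrib2 card.empty add_0_right mult_1_right)
    moreover have "sum ?F Z = sum ?F W" unfolding sumZ by (simp add: True)
    ultimately have "(d + 1) * sum ?F Z \<le> (k + 1) * d * N" by (simp only: add_le_imp_le_diff)
    then show ?thesis by (rule small)
  next
    case False
    then have E1: "card E \<ge> 1" using WE by (simp add: Suc_leI card_gt_0_iff)
    show ?thesis
    proof (cases "card W \<le> M")
      case True
      have "(d + 1) * sum ?F Z \<le> (d + 1) * (sum ?F W + card ?Q)"
        unfolding sumZ using E_hub by (intro mult_le_mono2) simp
      also have "\<dots> \<le> (k + 1) * d * (card S + card W)"
        unfolding sumW by (rule hub_bound[OF fin \<open>finite W\<close> k d True L])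
      \<comment> \<open>An element of \<open>E\<close> counts in \<open>N\<close> but not in
        \<open>card S + card W\<close>, which makes up for the 1 subtracted in
        \<open>N\<close>.\<close>
      also have "\<dots> \<le> (k + 1) * d * N" using E1 by (intro mult_le_mono2) (simp add: N_def cZ)
      finally show ?thesis by (rule small)
    next
      case False
      then have "S \<noteq> {} \<or> W \<noteq> {}" by auto
      from strip_bound[OF fin \<open>finite W\<close> this k d]
      have "(d + 1) * sum ?F W \<le> (k + 1) * d * (card S + card W)" unfolding sumW by (rule add_leD1)
      also have "\<dots> \<le> (k + 1) * d * N" using E1 by (intro mult_le_mono2) (simp add: N_def cZ)
      finally have "real (d + 1) * real (sum ?F W) \<le> real ((k + 1) * d) * real N"
        by (simp only: flip: of_nat_mult)
      then have "real (sum ?F W) \<le> real ((k + 1) * d) / real (d + 1) * real N"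
        by (simp add: pos_le_divide_eq mult.commute)
      moreover have "real (sum ?F E) \<le> \<epsilon> * M" using E_const M by (meson of_nat_mono order_trans)
      \<comment> \<open>\<open>N \<ge> card W > M\<close>, again because \<open>E\<close> is
        nonempty.\<close>
      moreover have "\<epsilon> * M < \<epsilon> * N" using False E1 \<epsilon> by (simp add: N_def cZ)
      ultimately show ?thesis unfolding c N(2) sumZ by (simp add: distrib_right)
    qed
  qed
qed


section \<open>Components and branchings\<close>

text \<open>Serves to place a connected subdigraph inside a weak component. By finiteness, some
  extension with property \<open>P\<close> has the largest number of vertices plus arcs, and it is
  maximal.\<close>

lemma subgraph_extends_to_max_subgraph:
  assumes "fin_digraph G" "subgraph H G" "P H"
  obtains C where "pre_digraph.max_subgraph G P C" "subgraph H C"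
proof -
  interpret fin_digraph G by fact
  define Q where "Q C \<longleftrightarrow> subgraph C G \<and> P C \<and> subgraph H C" for C
  define \<mu> where "\<mu> C = card (verts C) + card (arcs C)" for C :: "('a, 'b) pre_digraph"
  have "subgraph H H" using assms(2) by (meson subgraphE wf_digraph.subgraph_refl)
  then have "Q H" using assms by (simp add: Q_def)
  moreover have "\<forall>C. Q C \<longrightarrow> \<mu> C < Suc (card (verts G) + card (arcs G))"
    unfolding Q_def \<mu>_def less_Suc_eq_le by (auto intro!: add_mono card_mono)
  ultimately obtain C where C: "Q C" "\<And>C'. Q C' \<Longrightarrow> \<mu> C' \<le> \<mu> C"
    using ex_has_greatest_nat[of Q H \<mu>] by blast
  have "pre_digraph.max_subgraph G P C"
  proof (rule pre_digraph.max_subgraphI)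
    show "P C" "subgraph C G" using C by (auto simp: Q_def)
    fix C' assume *: "C \<noteq> C'" "subgraph C C'" "subgraph C' G"
    show "\<not> P C'"
    proof
      assume "P C'"
      then have "\<mu> C' \<le> \<mu> C" using * C(1) by (intro C(2)) (auto simp: Q_def intro: subgraph_trans)
      moreover have sub: "verts C \<subseteq> verts C'" "arcs C \<subseteq> arcs C'" using * by auto
      moreover have fin: "finite (verts C')" "finite (arcs C')"
        using *(3) fin_digraph_subgraph fin_digraph.finite_verts fin_digraph.finite_arcs by blast+
      moreover have "card (verts C) \<le> card (verts C')" "card (arcs C) \<le> card (arcs C')"
        using sub fin by (auto intro: card_mono)
      ultimately have "card (verts C) = card (verts C')" "card (arcs C) = card (arcs C')"
        by (simp_all add: \<mu>_def)
      with sub fin have "verts C = verts C'" "arcs C = arcs C'" by (simp_all add: card_subset_eq)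
      then have "C = C'" using *(2) by (auto simp: subgraph_def compatible_def)
      with * show False by simp
    qed
  qed
  with C show thesis using that by (auto simp: Q_def)
qed

text \<open>The last arc of a nonempty path would enter \<open>u\<close>.\<close>

lemma apath_into_source:
  assumes "pre_digraph.apath G r p u" "\<And>e. e \<in> arcs G \<Longrightarrow> head G e \<noteq> u"
  shows "r = u"
proof (cases p rule: rev_cases)
  case Nil
  then show ?thesis using assms by (simp add: pre_digraph.apath_def pre_digraph.awalk_def pre_digraph.cas.simps)
next
  case (snoc q e)
  then show ?thesis using assms
    by (auto simp: pre_digraph.apath_def pre_digraph.awalk_def pre_digraph.cas.simps
        pre_digraph.cas_append_iff)
qed

text \<open>Two arcs of \<open>B\<close> with a common head lie in one component. Their tails have
  no entering arcs, so both equal its root, and the arcs give two paths from the root to the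
  head.\<close>

lemma branching_inj_on_head:
  assumes "fin_digraph D"
    and bip: "\<And>e e'. e \<in> arcs D \<Longrightarrow> e' \<in> arcs D \<Longrightarrow> head D e \<noteq> tail D e'"
    and B: "branching B D"
  shows "inj_on (head D) (arcs B)"
proof (rule inj_onI)
  interpret D: fin_digraph D by fact
  have BD: "subgraph B D" using B by (simp add: branching_def spanning_def)
  interpret B: fin_digraph B using BD by (rule D.fin_digraph_subgraph)
  have th: "tail B = tail D" "head B = head D" using BD by (auto simp: compatible_def)
  have BDa: "arcs B \<subseteq> arcs D" using BD by auto
  fix e1 e2 assume e: "e1 \<in> arcs B" "e2 \<in> arcs B" and eq: "head D e1 = head D e2"
  \<comment> \<open>The two arcs with their ends are connected through the common head; the
    component containing them is obtained by extending \<open>H\<close>.\<close>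
  define H where "H = B\<lparr>verts := {tail D e1, tail D e2, head D e1}, arcs := {e1, e2}\<rparr>"
  have wfH: "wf_digraph H" by unfold_locales (auto simp: H_def th eq)
  have HB: "subgraph H B"
    using e wfH B.wf_digraph B.wellformed
    by (intro subgraphI) (auto simp: H_def compatible_def simp flip: th)
  have "Digraph_Component.connected H"
  proof -
    let ?S = "mk_symmetric H"
    interpret S: pair_wf_digraph ?S using wfH by (rule wf_digraph.wellformed_mk_symmetric)
    have adj: "tail D e1 \<rightarrow>\<^bsub>?S\<^esub> head D e1" "head D e1 \<rightarrow>\<^bsub>?S\<^esub> tail D e1"
      "tail D e2 \<rightarrow>\<^bsub>?S\<^esub> head D e1" "head D e1 \<rightarrow>\<^bsub>?S\<^esub> tail D e2"
      using eq by (auto simp: parcs_mk_symmetric H_def th)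
    have VH: "verts H = {tail D e1, tail D e2, head D e1}" by (simp add: H_def)
    have "u \<rightarrow>\<^sup>*\<^bsub>?S\<^esub> head D e1 \<and> head D e1 \<rightarrow>\<^sup>*\<^bsub>?S\<^esub> u" if "u \<in> verts H" for u
      using that S.reachable_adjI adj[unfolded with_proj_simps] S.reachable_refl[of "head D e1"] unfolding VH
      by (auto simp: VH)
    then show ?thesis
      using wfH VH by (intro wf_digraph.connectedI) (blast intro: S.reachable_trans)+
  qed
  with HB obtain C where C: "weak_component C B" "subgraph H C"
    using subgraph_extends_to_max_subgraph[OF B.fin_digraph] unfolding weak_component_def by metis
  from C(1) have CB: "subgraph C B" by (simp add: weak_component_def pre_digraph.max_subgraph_def)
  then have thC: "tail C = tail D" "head C = head D" and CD: "arcs C \<subseteq> arcs D"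
    using th BDa by (auto simp: compatible_def)
  have eC: "e1 \<in> arcs C" "e2 \<in> arcs C" and vC: "tail D e1 \<in> verts C" "tail D e2 \<in> verts C" "head D e1 \<in> verts C"
    using C(2) by (auto simp: H_def subgraph_def)
  from C(1) B obtain r where r: "arborescence C r" by (auto simp: branching_def)
  have root: "r = u" if u: "u \<in> {tail D e1, tail D e2}" for u
  proof -
    obtain p where "pre_digraph.apath C r p u" using r u vC by (auto simp: arborescence_def)
    then show ?thesis
      by (rule apath_into_source) (use u bip CD eC thC in auto)
  qed
  \<comment> \<open>Paths are lists of arcs, so uniqueness of the path also excludes two parallel
    arcs.\<close>
  have "pre_digraph.apath C r [a] (head D e1)" if "a \<in> {e1, e2}" for a
    using that root[of "tail D a"] vC eC eq bip[of a a] CD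
    by (auto simp: pre_digraph.apath_def pre_digraph.awalk_def pre_digraph.cas.simps
        pre_digraph.awalk_verts.simps thC)
  moreover have "\<exists>!p. pre_digraph.apath C r p (head D e1)"
    using r vC by (simp add: arborescence_def)
  ultimately have "[e1] = [e2]" by blast
  then show "e1 = e2" by simp
qed

section \<open>Criteria for acyclicity and small fractional arboricity\<close>

text \<open>On a cycle the head of the last arc is the tail of the first.\<close>

lemma acyclic_digraph_if_heads_not_tails:
  assumes bip: "\<And>e e'. e \<in> arcs D \<Longrightarrow> e' \<in> arcs D \<Longrightarrow> head D e \<noteq> tail D e'"
  shows "acyclic_digraph D"
proof -
  have False if cyc: "pre_digraph.cycle D p" for p
  proof -
    obtain u where u: "pre_digraph.awalk D u p u" "p \<noteq> []"
      using cyc by (auto simp: pre_digraph.cycle_def)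
    obtain e es where p: "p = e # es" using u(2) by (cases p) auto
    obtain e' es' where p': "p = es' @ [e']" using u(2) by (cases p rule: rev_cases) auto
    have "tail D e = u" using u(1) p by (simp add: pre_digraph.awalk_def pre_digraph.cas.simps)
    moreover have "head D e' = u"
      using u(1) p' by (simp add: pre_digraph.awalk_def pre_digraph.cas.simps pre_digraph.cas_append_iff)
    moreover have "e \<in> arcs D" using u(1) p by (simp add: pre_digraph.awalk_def)
    moreover have "e' \<in> arcs D" using u(1) p' by (simp add: pre_digraph.awalk_def)
    ultimately show False using bip by metis
  qed
  then show ?thesis by (auto simp: acyclic_digraph_def)
qed

lemma fractional_arboricity_less:
  assumes "fin_digraph D" "card (verts D) > 1"
    and "\<And>H. subgraph H D \<Longrightarrow> card (verts H) > 1 \<Longrightarrow>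
      real (card (arcs H)) < b * (real (card (verts H)) - 1)"
  shows "fractional_arboricity D < b"
proof -
  interpret fin_digraph D by fact
  let ?R = "{real (card (arcs H)) / (real (card (verts H)) - 1) | H.
          subgraph H D \<and> card (verts H) > 1}"
  \<comment> \<open>The ratio depends only on the vertex and arc sets, so finitely many values occur
    and the maximum is attained.\<close>
  have "?R \<subseteq> (\<lambda>(V, A). real (card A) / (real (card V) - 1)) ` (Pow (verts D) \<times> Pow (arcs D))"
    by (fastforce simp: subgraph_def)
  then have "finite ?R" by (rule finite_subset) simp
  moreover have "?R \<noteq> {}" using assms(2) subgraph_refl by auto
  moreover have "x < b" if "x \<in> ?R" for x
    using that assms(3) by (auto simp: pos_divide_less_eq)
  ultimately show ?thesis unfolding fractional_arboricity_def by simp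
qed

section \<open>The digraph of an arc placement\<close>

text \<open>Sources are the numbers below \<open>n\<close>, and sink \<open>y\<close> is the vertex
  \<open>n + y\<close>. The arc number \<open>y * (k + 1) + i\<close> with \<open>i \<le> k\<close>
  encodes the pair of a sink \<open>y\<close> and an index \<open>i\<close>, so arcs stay distinct
  even if \<open>f\<close> repeats a source.\<close>

definition source_digraph :: "nat \<Rightarrow> nat \<Rightarrow> nat \<Rightarrow> (nat \<Rightarrow> nat \<Rightarrow> nat) \<Rightarrow> (nat, nat) pre_digraph" where
  "source_digraph k n m f =
    \<lparr> verts = {..<n + m}, arcs = {..<m * (k + 1)},
      tail = (\<lambda>a. f (a div (k + 1)) (a mod (k + 1))), head = (\<lambda>a. n + a div (k + 1)) \<rparr>"

lemma source_digraph_simps [simp]: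
  "verts (source_digraph k n m f) = {..<n + m}"
  "arcs (source_digraph k n m f) = {..<m * (k + 1)}"
  "tail (source_digraph k n m f) a = f (a div (k + 1)) (a mod (k + 1))"
  "head (source_digraph k n m f) a = n + a div (k + 1)"
  by (simp_all add: source_digraph_def)

lemma arc_index: "a < m * (k + 1) \<Longrightarrow> a div (k + 1) < m \<and> a mod (k + 1) \<le> k" for a k m :: nat
  using less_mult_imp_div_less[of a m "k + 1"] mod_less_divisor[of "k + 1" a] by linarith

context
  fixes k n m :: nat and f :: "nat \<Rightarrow> nat \<Rightarrow> nat"
  assumes f: "\<And>y i. y < m \<Longrightarrow> i \<le> k \<Longrightarrow> f y i < n" and m: "m > 0"
begin

lemma source_digraph_tail_less: "a < m * (k + 1) \<Longrightarrow> f (a div (k + 1)) (a mod (k + 1)) < n"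
  using arc_index f by blast

lemma source_digraph_head_neq_tail:
  assumes "e \<in> arcs (source_digraph k n m f)" "e' \<in> arcs (source_digraph k n m f)"
  shows "head (source_digraph k n m f) e \<noteq> tail (source_digraph k n m f) e'"
  using source_digraph_tail_less[of e'] assms by (auto simp del: mult_Suc_right)

lemma multi_digraph_source_digraph: "multi_digraph (source_digraph k n m f)"
proof
  fix e assume e: "e \<in> arcs (source_digraph k n m f)"
  then show "tail (source_digraph k n m f) e \<in> verts (source_digraph k n m f)"
    using source_digraph_tail_less[of e] by simp
  show "head (source_digraph k n m f) e \<in> verts (source_digraph k n m f)"
    using arc_index[of e m k] e by simp
  show "tail (source_digraph k n m f) e \<noteq> head (source_digraph k n m f) e"
    using source_digraph_head_neq_tail[OF e e] by simp
qed (use m in auto)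

lemma bipartite_source_digraph: "bipartite_digraph (source_digraph k n m f)"
  unfolding bipartite_digraph_def
proof (intro exI conjI ballI disjI1)
  show "{..<n} \<union> {n..<n + m} = verts (source_digraph k n m f)" by auto
  fix e assume e: "e \<in> arcs (source_digraph k n m f)"
  show "tail (source_digraph k n m f) e \<in> {..<n}"
    using source_digraph_tail_less[of e] e by simp
  show "head (source_digraph k n m f) e \<in> {n..<n + m}"
    using arc_index[of e m k] e by simp
qed auto

lemma max_in_degree_source_digraph: "max_in_degree (source_digraph k n m f) \<le> k + 1"
proof -
  let ?D = "source_digraph k n m f"
  have "in_degree ?D v \<le> k + 1" for v
  proof -
    \<comment> \<open>The arcs into a sink are a block of consecutive numbers; a vertex
      \<open>v < n\<close> has none, so the truncated \<open>v - n\<close> is harmless.\<close>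
    have "in_arcs ?D v \<subseteq> {(v - n) * (k + 1)..<(v - n) * (k + 1) + (k + 1)}"
    proof
      fix a assume "a \<in> in_arcs ?D v"
      then have v: "v - n = a div (k + 1)" by auto
      have "a mod (k + 1) < k + 1" by simp
      with div_mult_mod_eq[of a "k + 1"]
      show "a \<in> {(v - n) * (k + 1)..<(v - n) * (k + 1) + (k + 1)}"
        unfolding atLeastLessThan_iff v by linarith
    qed
    from card_mono[OF _ this] show ?thesis by (simp add: in_degree_def)
  qed
  then show ?thesis using m unfolding max_in_degree_def by (subst Max_le_iff) auto
qed

text \<open>For given sources \<open>S\<close> and sinks \<open>Z\<close> of a subdigraph, the
  extreme case contains all arcs from \<open>S\<close> to \<open>Z\<close>; these are what the sum
  in the hypothesis counts.\<close>

lemma fractional_arboricity_source_digraph_less: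
  assumes "\<And>S Z. finite S \<Longrightarrow> Z \<subseteq> {..<m} \<Longrightarrow> card S + card Z > 1 \<Longrightarrow>
    real (\<Sum>y\<in>Z. card {i \<in> {..k}. f y i \<in> S}) < b * (real (card S + card Z) - 1)"
  shows "fractional_arboricity (source_digraph k n m f) < b"
proof (rule fractional_arboricity_less)
  let ?D = "source_digraph k n m f"
  interpret multi_digraph ?D by (rule multi_digraph_source_digraph)
  show "fin_digraph ?D" by (rule fin_digraph)
  have "n > 0" using f[of 0 0] m by simp
  then show "card (verts ?D) > 1" using m by simp
  fix H assume H: "subgraph H ?D" and card: "card (verts H) > 1"
  define S where "S = verts H \<inter> {..<n}"
  define Z where "Z = {y. n + y \<in> verts H}"
  have VH: "verts H \<subseteq> {..<n + m}" using subgraph_imp_subverts[OF H] by simp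
  have HZ: "verts H = S \<union> (+) n ` Z"
    by (auto simp: S_def Z_def image_iff) (metis le_add_diff_inverse not_less)
  have finS: "finite S" by (simp add: S_def)
  have Zm: "Z \<subseteq> {..<m}" using VH by (auto simp: Z_def)
  then have finZ: "finite Z" using finite_subset by blast
  have "S \<inter> (+) n ` Z = {}" by (auto simp: S_def)
  then have cH: "card (verts H) = card S + card Z"
    unfolding HZ using finS finZ by (subst card_Un_disjoint) (auto simp: card_image)
  let ?P = "SIGMA y:Z. {i \<in> {..k}. f y i \<in> S}"
  let ?g = "\<lambda>a. (a div (k + 1), a mod (k + 1))"
  have "card (arcs H) \<le> card ?P"
  proof (rule card_inj_on_le)
    show "inj_on ?g (arcs H)"
      by (rule inj_onI) (metis Pair_inject div_mult_mod_eq)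
    show "?g ` arcs H \<subseteq> ?P"
    proof (rule image_subsetI)
      fix a assume a: "a \<in> arcs H"
      have "wf_digraph H" and th: "tail H = tail ?D" "head H = head ?D" and "a < m * (k + 1)"
        using H a by (auto simp: subgraph_def compatible_def)
      then have "tail ?D a \<in> verts H" "head ?D a \<in> verts H"
        using a by (metis wf_digraph.wellformed)+
      then show "?g a \<in> ?P"
        using source_digraph_tail_less[of a] arc_index[of a m k] \<open>a < m * (k + 1)\<close> 
        by (simp add: S_def Z_def)
    qed
    show "finite ?P" using finZ by simp
  qed
  also have "card ?P = (\<Sum>y\<in>Z. card {i \<in> {..k}. f y i \<in> S})" using finZ by simp
  finally have "card (arcs H) \<le> \<dots>" .
  with assms[OF finS Zm] card show "real (card (arcs H)) < b * (real (card (verts H)) - 1)"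
    unfolding cH by (meson le_less_trans of_nat_le_iff)
qed

text \<open>Injectivity on heads allows each branching at most \<open>m\<close> of the
  \<open>m * (k + 1)\<close> arcs, so the last one would need \<open>m\<close> arcs, but its tails
  are among \<open>n\<close> sources.\<close>

lemma source_digraph_not_decomposable:
  assumes dn: "d * n < m"
    and dec: "decomposition (source_digraph k n m f) {1..k + 1} B"
    and br: "\<And>i. i \<in> {1..k + 1} \<Longrightarrow> branching (B i) (source_digraph k n m f)"
    and out: "max_out_degree (B (k + 1)) \<le> d"
  shows False
proof -
  let ?D = "source_digraph k n m f"
  interpret D: multi_digraph ?D by (rule multi_digraph_source_digraph)
  have sub: "subgraph (B i) ?D" if "i \<in> {1..k + 1}" for i
    using dec that by (simp add: decomposition_def)
  have each: "card (arcs (B i)) \<le> m" if "i \<in> {1..k + 1}" for i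
  proof -
    have "inj_on (head ?D) (arcs (B i))"
      using D.fin_digraph source_digraph_head_neq_tail br[OF that] by (rule branching_inj_on_head)
    moreover have "head ?D ` arcs (B i) \<subseteq> {n..<n + m}"
    proof (rule image_subsetI)
      fix a assume "a \<in> arcs (B i)"
      then have "a < m * (k + 1)" using sub[OF that] by (auto simp: subgraph_def)
      then show "head ?D a \<in> {n..<n + m}" using arc_index[of a m k] by simp
    qed
    ultimately have "card (arcs (B i)) \<le> card {n..<n + m}" by (rule card_inj_on_le) simp
    then show ?thesis by simp
  qed
  have last: "card (arcs (B (k + 1))) \<le> d * n"
  proof -
    let ?B = "B (k + 1)"
    have V: "verts ?B = verts ?D" using br[of "k + 1"] by (simp add: branching_def spanning_def)
    have sB: "subgraph ?B ?D" by (rule sub) simp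
    then have t: "tail ?B = tail ?D" and A: "arcs ?B \<subseteq> arcs ?D"
      by (auto simp: subgraph_def compatible_def)
    have "tail ?B a \<in> {..<n}" if "a \<in> arcs ?B" for a
      using that A source_digraph_tail_less[of a] unfolding t by auto
    then have "arcs ?B = (\<Union>x<n. out_arcs ?B x)" unfolding out_arcs_def by blast
    then have "card (arcs ?B) \<le> (\<Sum>x<n. out_degree ?B x)"
      using card_UN_le[of "{..<n}" "out_arcs ?B"] by (simp add: out_degree_def)
    also have "\<dots> \<le> (\<Sum>x<n. d)"
    proof (rule sum_mono)
      fix x assume "x \<in> {..<n}"
      \<comment> \<open>A branching is spanning, so the maximum ranges over every source.\<close>
      then have "out_degree ?B x \<le> max_out_degree ?B"
        unfolding max_out_degree_def V by (intro Max_ge) auto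
      with out show "out_degree ?B x \<le> d" by simp
    qed
    finally show ?thesis by (simp add: mult.commute)
  qed
  have "pre_digraph.Union ?D (B ` {1..k + 1}) = ?D" using dec by (simp add: decomposition_def)
  from arg_cong[OF this, of arcs] have "arcs ?D = (\<Union>i\<in>{1..k + 1}. arcs (B i))"
    unfolding pre_digraph.Union_def by (simp only: pre_digraph.simps image_image UN_simps)
  then have "m * (k + 1) \<le> (\<Sum>i\<in>{1..k + 1}. card (arcs (B i)))"
    using card_UN_le[of "{1..k + 1}" "\<lambda>i. arcs (B i)"] by (metis card_lessThan finite_atLeastAtMost source_digraph_simps(2))
  also have "\<dots> = (\<Sum>i\<in>{1..k}. card (arcs (B i))) + card (arcs (B (k + 1)))" by simp
  also have "(\<Sum>i\<in>{1..k}. card (arcs (B i))) \<le> (\<Sum>i\<in>{1..k}. m)"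
    by (intro sum_mono each) auto
  finally show False using last dn by simp
qed

end


section \<open>Choice of the parameters\<close>

theorem theorem1p7:
  fixes k d :: nat and \<epsilon> :: real
  assumes "k > 0" and "d > 0" and "\<epsilon> > 0"
  shows "\<exists>D :: (nat, nat) pre_digraph.
    multi_digraph D \<and> acyclic_digraph D \<and> bipartite_digraph D \<and>
    fractional_arboricity D < real k + (real d - real k) / (real d + 1) + \<epsilon> \<and>
    max_in_degree D \<le> k + 1 \<and>
    \<not> (\<exists>B :: nat \<Rightarrow> (nat, nat) pre_digraph.
        decomposition D {1..k+1} B \<and>
        (\<forall>i \<in> {1..k+1}. branching (B i) D) \<and>
        max_out_degree (B (k+1)) \<le> d)"
proof -
  \<comment> \<open>\<open>M\<close> is the number of strip sinks from which
    \<open>\<epsilon>\<close> per vertex pays for all \<open>(k * d + 1) * (k + 1)\<close> arcs at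
    hubs.\<close>
  define M where "M = nat \<lceil>real ((k * d + 1) * (k + 1)) / \<epsilon>\<rceil>"
  have M: "real ((k * d + 1) * (k + 1)) \<le> \<epsilon> * M"
  proof -
    have "real ((k * d + 1) * (k + 1)) / \<epsilon> \<le> M" unfolding M_def by linarith
    then show ?thesis using \<open>\<epsilon> > 0\<close> by (simp only: pos_divide_le_eq mult.commute)
  qed
  \<comment> \<open>The gap between hubs has room for \<open>M + 1\<close> windows of length
    \<open>k + 1\<close>, and \<open>n\<close> is chosen so that all hubs are sources.\<close>
  define L where "L = (k + 1) * (M + 1)"
  define n where "n = (k * d + 1) * (k + 1) * L"
  \<comment> \<open>A strip position \<open>j\<close> needs \<open>j + k < n\<close>, which leaves
    \<open>n - k\<close> positions with \<open>d\<close> sinks each.\<close>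
  define b where "b = d * (n - k)"
  define m where "m = b + k * d + 1"
  let ?f = "spread k d L b"
  have "L > 0" by (simp add: L_def)
  have "k + 1 \<le> (k + 1) * (M + 1)" by simp
  also have "\<dots> \<le> n" unfolding n_def L_def by simp
  finally have kn: "k < n" by simp
  \<comment> \<open>The additional sinks replace the \<open>k * d\<close> ones missing at the end of
    the strip and provide one more, so that \<open>m\<close> exceeds \<open>d * n\<close>.\<close>
  then have m: "m = d * n + 1" by (simp add: m_def b_def diff_mult_distrib2 mult.commute)
  have f: "?f y i < n" if "y < m" "i \<le> k" for y i
  proof (cases "y < b")
    case True
    then have "y div d < n - k" unfolding b_def by (simp add: less_mult_imp_div_less mult.commute)
    then show ?thesis using True that by (simp add: spread_def)
  next
    case False
    then have "y - b \<le> k * d" using that by (simp add: m_def)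
    then have "(y - b) * (k + 1) \<le> k * d * (k + 1)" by (rule mult_le_mono1)
    then have "(y - b) * (k + 1) + i < (k * d + 1) * (k + 1)"
      using that(2) unfolding distrib_right[of "k * d"] by (intro add_le_less_mono) simp_all
    then have "((y - b) * (k + 1) + i) * L < n" unfolding n_def using \<open>L > 0\<close> by (simp only: mult_less_mono1)
    then show ?thesis using False by (simp add: spread_def)
  qed
  have "m > 0" by (simp add: m)
  note G = f \<open>m > 0\<close>
  let ?D = "source_digraph k n m ?f"
  have "multi_digraph ?D" using G by (rule multi_digraph_source_digraph)
  moreover have "acyclic_digraph ?D"
    using source_digraph_head_neq_tail[OF G] by (rule acyclic_digraph_if_heads_not_tails)
  moreover have "bipartite_digraph ?D" using G by (rule bipartite_source_digraph)
  moreover have "max_in_degree ?D \<le> k + 1" using G by (rule max_in_degree_source_digraph)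
  moreover have "fractional_arboricity ?D < real k + (real d - real k) / (real d + 1) + \<epsilon>"
    by (rule fractional_arboricity_source_digraph_less[OF G], assumption, assumption)
      (rule spread_bound[OF _ assms _ _ M L_def], auto simp: m_def)
  moreover have "\<not> (\<exists>B. decomposition ?D {1..k + 1} B \<and> (\<forall>i\<in>{1..k + 1}. branching (B i) ?D) \<and>
      max_out_degree (B (k + 1)) \<le> d)"
  proof
    assume "\<exists>B. decomposition ?D {1..k + 1} B \<and> (\<forall>i\<in>{1..k + 1}. branching (B i) ?D) \<and>
      max_out_degree (B (k + 1)) \<le> d"
    then obtain B where "decomposition ?D {1..k + 1} B"
      "\<And>i. i \<in> {1..k + 1} \<Longrightarrow> branching (B i) ?D" "max_out_degree (B (k + 1)) \<le> d" by blast
    moreover have "d * n < m" by (simp add: m)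
    ultimately show False using source_digraph_not_decomposable[where f = ?f, OF G] by blast
  qed
  ultimately show ?thesis by blast
qed

end
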